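(* Let $(t_n)$ be a sequence of integers $t_n\ge 2$ with $t_n=o(\log\log n)$ as $n\to\infty$, and let $(S_n)$ be a sequence of positive integers such that, for all sufficiently large $n$, $S_n\ge N_n$ and $S_n$ is $t_n$-free. Then for all sufficiently large $n$, $\sigma(S_n)<e^\gamma S_n\log\log S_n$.
   Context: An integer $m$ is $t$-free iff $p^t\nmid m$ for every prime $p$. $\sigma$ is the sum-of-divisors function and $\gamma$ the Euler–Mascheroni constant. $p_k$ denotes the $k$-th prime and $N_k=\prod_{i=1}^k p_i$ the $k$-th primorial number. *)

theory Defs
  imports "HOL-Analysis.Analysis" "HOL-Library.Landau_Symbols" "HOL-Library.Infinite_Set"
begin

definition divisor_sigma :: "nat \<Rightarrow> nat" where
  "divisor_sigma m = (\<Sum>d\<in>{d. d dvd m}. d)"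

definition t_free :: "nat \<Rightarrow> nat \<Rightarrow> bool" where
  "t_free t m \<longleftrightarrow> (\<forall>p. prime p \<longrightarrow> \<not> p ^ t dvd m)"

text \<open>k-th prime, 1-indexed: p_1 = 2\<close>
definition nth_prime1 :: "nat \<Rightarrow> nat" where
  "nth_prime1 k = enumerate {p::nat. prime p} (k - 1)"

definition primorial :: "nat \<Rightarrow> nat" where
  "primorial k = (\<Prod>i\<in>{1..k}. nth_prime1 i)"

end

theory Submission
  imports Defs "HOL-Number_Theory.Prime_Powers" "HOL-Real_Asymp.Real_Asymp"
begin

text \<open>
  For a \<open>t\<close>-free \<open>S\<close> the quotient \<open>\<sigma>(S) / S\<close> is at most the product of \<open>1 + 1/p + \<dots> + 1/p^(t-1)\<close>
  over the primes \<open>p\<close> dividing \<open>S\<close>. Put \<open>y = ln S\<close>. At most \<open>y / ln y\<close> of these primes exceed \<open>y\<close>, and they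
  contribute a factor \<open>exp (O(1 / ln y))\<close>. Among the primes up to \<open>y\<close>, the factor of \<open>p = 2\<close> saves
  \<open>1 - 2^(-t)\<close> over the full Euler product, which by Mertens' third theorem is at most
  \<open>exp \<gamma> * ln y * exp (O(1 / ln y))\<close>. The saving wins as soon as \<open>2^t\<close> is small compared with \<open>ln y\<close>.

  For the upper bound in Mertens' third theorem, let \<open>L(x)\<close> be the logarithm of the Euler product over
  \<open>p \<le> x\<close>. Mertens' first theorem and Abel summation show that \<open>L(x) - ln (ln x)\<close> can never drop by
  more than \<open>O(1 / ln x)\<close> after \<open>x\<close>. If it exceeded \<open>\<gamma>\<close> by more than that at some \<open>x\<close>, then
  \<open>L(e^k)\<close> would exceed the harmonic number \<open>H\<^sub>k\<close> by a fixed \<open>\<eta> > 0\<close> for all large \<open>k\<close>. Weighting by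
  \<open>e^(-\<delta>k)\<close> and letting \<open>\<delta>\<close> tend to \<open>0\<close> turns this into \<open>ln \<zeta>(1 + \<delta>) \<ge> - ln (1 - e^(-\<delta>)) + \<eta> + o(1)\<close>,
  contradicting \<open>\<zeta>(1 + \<delta>) \<le> 1 + 1 / \<delta>\<close>.
\<close>

subsection \<open>Primes up to a real number\<close>

definition primes_upto :: "real \<Rightarrow> nat set" where
  "primes_upto x = {p. prime p \<and> real p \<le> x}"

lemma primes_upto_subset: "primes_upto x \<subseteq> {1..nat \<lfloor>x\<rfloor>}"
  by (auto simp: primes_upto_def le_nat_floor dest: prime_gt_0_nat)

lemma finite_primes_upto [simp]: "finite (primes_upto x)"
  by (rule finite_subset[OF primes_upto_subset]) simp

lemma primes_upto_imp_prime: "p \<in> primes_upto x \<Longrightarrow> prime p"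
  by (simp add: primes_upto_def)

lemma primes_upto_mono: "x \<le> y \<Longrightarrow> primes_upto x \<subseteq> primes_upto y"
  by (auto simp: primes_upto_def)

lemma primes_upto_less_2: "x < 2 \<Longrightarrow> primes_upto x = {}"
  by (auto simp: primes_upto_def dest!: prime_ge_2_nat)

lemma primes_upto_nat_floor: "x \<ge> 0 \<Longrightarrow> primes_upto (real (nat \<lfloor>x\<rfloor>)) = primes_upto x"
  unfolding primes_upto_def of_nat_le_iff by (simp add: le_nat_iff le_floor_iff)

lemma sum_primes_upto_Suc:
  "sum f (primes_upto (real (Suc n))) =
     sum f (primes_upto (real n)) + (if prime (Suc n) then f (Suc n) else 0)"
proof -
  have "primes_upto (real (Suc n)) =
      (if prime (Suc n) then insert (Suc n) (primes_upto (real n)) else primes_upto (real n))"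
    by (auto simp: primes_upto_def le_Suc_eq simp del: of_nat_Suc)
  moreover have "Suc n \<notin> primes_upto (real n)"
    by (simp add: primes_upto_def)
  ultimately show ?thesis
    by (simp add: add.commute)
qed

lemma sum_ln_prime_factors_le:
  assumes "n > 0" "A \<subseteq> prime_factors n"
  shows "(\<Sum>p\<in>A. ln (real p)) \<le> ln (real n)"
proof -
  have "prime p" if "p \<in> A" for p
    using assms(2) that by auto
  then have "(\<Sum>p\<in>A. ln (real p)) = (\<Sum>p\<in>A. mangoldt p)"
    by simp
  also have "\<dots> \<le> (\<Sum>d | d dvd n. mangoldt d)"
    using assms by (intro sum_mono2) (auto simp: mangoldt_nonneg)
  also have "\<dots> = ln (real n)"
    using assms(1) by (simp add: mangoldt_sum)
  finally show ?thesis .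
qed

subsection \<open>Chebyshev's bound and Mertens' first theorem\<close>

lemma sum_ln_primes_between_le_ln_binomial:
  assumes "2 * k \<le> n"
  shows "(\<Sum>p\<in>primes_upto (real n) - primes_upto (real (n - k)). ln (real p)) \<le> ln (real (n choose k))"
proof (rule sum_ln_prime_factors_le)
  show "n choose k > 0" using assms by simp
  show "primes_upto (real n) - primes_upto (real (n - k)) \<subseteq> prime_factors (n choose k)"
  proof
    fix p assume "p \<in> primes_upto (real n) - primes_upto (real (n - k))"
    then have p: "prime p" "n - k < p" "p \<le> n" by (auto simp: primes_upto_def not_le)
    have "fact k * fact (n - k) * (n choose k) = (fact n :: nat)"
      using assms by (intro binomial_fact_lemma) simp
    then have "p dvd fact k * fact (n - k) * (n choose k)"
      using p by (simp add: prime_dvd_fact_iff)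
    moreover have "\<not> p dvd fact k" "\<not> p dvd fact (n - k)"
      using p assms by (simp_all add: prime_dvd_fact_iff)
    ultimately have "p dvd (n choose k)"
      using p by (simp add: prime_dvd_mult_iff)
    then show "p \<in> prime_factors (n choose k)"
      using p(1) assms by (simp add: prime_factors_dvd)
  qed
qed

theorem sum_ln_primes_upto_le:
  assumes "n > 0"
  shows "(\<Sum>p\<in>primes_upto (real n). ln (real p)) \<le> 4 * ln 2 * (real n - 1)"
  using assms
proof (induction n rule: less_induct)
  case (less n)
  show ?case
  proof (cases "n = 1")
    case True
    then show ?thesis by (simp add: primes_upto_less_2)
  next
    case False
    define k where "k = n div 2"
    define h where "h = n - k"
    have h: "0 < h" "h < n" "2 * h \<le> n + 1"
      using less.prems False by (auto simp: h_def k_def)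
    have "(\<Sum>p\<in>primes_upto (real n) - primes_upto (real h). ln (real p)) \<le> ln (real (n choose k))"
      unfolding h_def by (rule sum_ln_primes_between_le_ln_binomial) (simp add: k_def)
    also have "\<dots> \<le> ln (2 ^ n)"
      using binomial_le_pow2[of n k] by (intro ln_mono) (simp_all add: k_def flip: of_nat_le_iff)
    finally have "(\<Sum>p\<in>primes_upto (real n) - primes_upto (real h). ln (real p)) \<le> real n * ln 2"
      by (simp add: ln_realpow)
    moreover have "(\<Sum>p\<in>primes_upto (real h). ln (real p)) \<le> 4 * ln 2 * (real h - 1)"
      using h by (intro less.IH)
    moreover have "(\<Sum>p\<in>primes_upto (real n). ln (real p)) =
        (\<Sum>p\<in>primes_upto (real n) - primes_upto (real h). ln (real p))
        + (\<Sum>p\<in>primes_upto (real h). ln (real p))"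
      using h by (intro sum.subset_diff primes_upto_mono) auto
    ultimately have "(\<Sum>p\<in>primes_upto (real n). ln (real p)) \<le> ln 2 * (real n + 4 * (real h - 1))"
      by (simp add: algebra_simps)
    also have "\<dots> \<le> ln 2 * (4 * (real n - 1))"
      using h by (intro mult_left_mono) auto
    finally show ?thesis by (simp add: algebra_simps)
  qed
qed

lemma card_multiples_upto:
  fixes d N :: nat
  assumes "d > 0"
  shows "card {m \<in> {1..N}. d dvd m} = N div d"
proof -
  have "{m \<in> {1..N}. d dvd m} = (\<lambda>k. d * k) ` {1..N div d}"
    using assms by (force simp: less_eq_div_iff_mult_less_eq mult.commute elim!: dvdE)
  then show ?thesis using assms by (simp add: card_image inj_on_def)
qed

lemma ln_fact_eq_sum_mangoldt:
  "ln (fact N) = (\<Sum>d=1..N. mangoldt d * real (N div d))"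
proof -
  have "ln (fact N) = (\<Sum>m=1..N. ln (real m))"
    unfolding fact_prod of_nat_prod by (subst ln_prod) auto
  also have "\<dots> = (\<Sum>m=1..N. \<Sum>d\<in>{d \<in> {1..N}. d dvd m}. mangoldt d)"
  proof (rule sum.cong)
    fix m assume m: "m \<in> {1..N}"
    then have "{d. d dvd m} = {d \<in> {1..N}. d dvd m}"
      by (auto dest: dvd_imp_le intro!: Nat.gr0I)
    then show "ln (real m) = (\<Sum>d\<in>{d \<in> {1..N}. d dvd m}. mangoldt d)"
      using m mangoldt_sum[of m, where ?'a = real] by simp
  qed simp
  also have "\<dots> = (\<Sum>d=1..N. \<Sum>m\<in>{m \<in> {1..N}. d dvd m}. mangoldt d)"
    by (rule sum.swap_restrict) auto
  also have "\<dots> = (\<Sum>d=1..N. mangoldt d * real (N div d))"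
    by (intro sum.cong refl) (use card_multiples_upto in auto)
  finally show ?thesis .
qed

lemma ln_fact_le: "ln (fact n) \<le> real n * ln (real n)"
proof -
  have "ln (fact n :: real) \<le> ln (real n ^ n)"
    using fact_le_power[of n, where ?'a = real] by (intro ln_mono) auto
  then show ?thesis by (simp add: ln_realpow)
qed

lemma ln_fact_ge: "real n * ln (real n) - real n \<le> ln (fact n)"
proof (cases "n = 0")
  case False
  have "(\<lambda>k. real n ^ k /\<^sub>R fact k) sums exp (real n)" by (rule exp_converges)
  then have "(\<Sum>k\<in>{n}. real n ^ k /\<^sub>R fact k) \<le> exp (real n)"
    by (intro sum_le_suminf[THEN order_trans]) (auto simp: sums_iff)
  then have "real n ^ n \<le> exp (real n) * fact n"
    by (simp add: field_simps)
  then have "ln (real n ^ n) \<le> ln (exp (real n) * fact n)"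
    using False by (intro ln_mono) auto
  then show ?thesis
    using False by (simp add: ln_realpow ln_mult)
qed simp

lemma sum_power_le_geometric:
  fixes r :: real
  assumes "0 \<le> r" "r < 1"
  shows "(\<Sum>k<n. r ^ k) \<le> 1 / (1 - r)"
  using assms sum_le_suminf[of "\<lambda>k. r ^ k" "{..<n}"]
  by (simp add: suminf_geometric summable_geometric)

lemma sum_primepow_upto_le:
  fixes f :: "nat \<Rightarrow> real"
  assumes "\<And>n. 0 \<le> f n"
  shows "(\<Sum>n | primepow n \<and> n \<le> N. f n) \<le> (\<Sum>p\<in>primes_upto (real N). \<Sum>k<N. f (p ^ Suc k))"
proof -
  let ?h = "\<lambda>(p, k). p ^ Suc k :: nat"
  let ?P = "primes_upto (real N) \<times> {..<N}"
  have inj: "inj_on ?h ?P"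
    by (rule inj_on_subset[OF bij_betw_imp_inj_on[OF bij_betw_primepows]])
       (auto simp: primes_upto_def)
  have "{n. primepow n \<and> n \<le> N} \<subseteq> ?h ` ?P"
  proof
    fix n assume "n \<in> {n. primepow n \<and> n \<le> N}"
    then obtain p k where pk: "prime p" "n = p ^ Suc k" "n \<le> N"
      by (auto simp: primepow_def gr0_conv_Suc)
    moreover have "Suc k < p ^ Suc k"
      using prime_gt_1_nat[OF pk(1)] by (intro power_gt_expt) simp
    moreover have "p \<le> p ^ Suc k"
      using prime_gt_0_nat[OF pk(1)] by (intro self_le_power) auto
    ultimately have "(p, k) \<in> ?P" "n = ?h (p, k)"
      by (auto simp: primes_upto_def simp del: power_Suc)
    then show "n \<in> ?h ` ?P" by blast
  qed
  then have "(\<Sum>n | primepow n \<and> n \<le> N. f n) \<le> (\<Sum>n\<in>?h ` ?P. f n)"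
    using assms by (intro sum_mono2) auto
  also have "\<dots> = (\<Sum>p\<in>primes_upto (real N). \<Sum>k<N. f (p ^ Suc k))"
    by (subst sum.reindex[OF inj]) (simp add: sum.cartesian_product case_prod_beta)
  finally show ?thesis .
qed

lemma sum_mangoldt_div_le:
  "(\<Sum>n=1..N. mangoldt n / real n) \<le> (\<Sum>p\<in>primes_upto (real N). ln (real p) / (real p - 1))"
proof -
  have "(\<Sum>n=1..N. mangoldt n / real n) = (\<Sum>n | primepow n \<and> n \<le> N. mangoldt n / real n)"
    by (intro sum.mono_neutral_right) (auto simp: mangoldt_def dest: primepow_gt_0_nat)
  also have "\<dots> \<le> (\<Sum>p\<in>primes_upto (real N). \<Sum>k<N. mangoldt (p ^ Suc k) / real (p ^ Suc k))"
    by (intro sum_primepow_upto_le) (simp add: mangoldt_nonneg)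
  also have "\<dots> \<le> (\<Sum>p\<in>primes_upto (real N). ln (real p) / (real p - 1))"
  proof (rule sum_mono)
    fix p assume "p \<in> primes_upto (real N)"
    then have p: "prime p" "real p > 1" by (auto simp: primes_upto_def dest: prime_gt_1_nat)
    have "(\<Sum>k<N. mangoldt (p ^ Suc k) / real (p ^ Suc k)) = (\<Sum>k<N. ln (real p) / real p * (1 / real p) ^ k)"
      using p by (intro sum.cong) (simp_all add: mangoldt_primepow power_divide del: power_Suc, simp)
    also have "\<dots> = ln (real p) / real p * (\<Sum>k<N. (1 / real p) ^ k)"
      by (rule sum_distrib_left[symmetric])
    also have "\<dots> \<le> ln (real p) / real p * (1 / (1 - 1 / real p))"
      using p by (intro mult_left_mono sum_power_le_geometric) auto
    also have "\<dots> = ln (real p) / (real p - 1)"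
      using p by (simp add: field_simps)
    finally show "(\<Sum>k<N. mangoldt (p ^ Suc k) / real (p ^ Suc k)) \<le> ln (real p) / (real p - 1)" .
  qed
  finally show ?thesis .
qed

\<comment> \<open>The decrease of \<open>(ln n + 2) / n\<close> dominates the summands.\<close>
lemma sum_ln_div_le:
  assumes "N \<ge> 1"
  shows "(\<Sum>n=2..N. ln (real n) / (real n * (real n - 1))) \<le> 2 - (ln (real N) + 2) / real N"
  using assms
proof (induction N rule: nat_induct_at_least)
  case (Suc N)
  define x where "x = real N"
  have x: "x \<ge> 1" using Suc by (simp add: x_def)
  have "(x + 1) * (ln (x + 1) - ln x) \<le> (x + 1) * (1 / x)"
    using x ln_diff_le[of "x + 1" x] by (intro mult_left_mono) auto
  also have "\<dots> \<le> 2" using x by (simp add: field_simps)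
  finally have "ln (x + 1) \<le> (x + 1) * (ln x + 2) - x * (ln (x + 1) + 2)"
    by (simp add: algebra_simps)
  then have "ln (x + 1) / ((x + 1) * x) \<le> ((x + 1) * (ln x + 2) - x * (ln (x + 1) + 2)) / ((x + 1) * x)"
    using x by (intro divide_right_mono) auto
  also have "\<dots> = (ln x + 2) / x - (ln (x + 1) + 2) / (x + 1)"
    using x by (simp add: diff_divide_distrib)
  finally show ?case using Suc by (simp add: x_def add.commute)
qed simp

lemma sum_primes_upto_ln_div_le:
  "(\<Sum>p\<in>primes_upto x. ln (real p) / (real p * (real p - 1))) \<le> 2"
proof (cases "x < 2")
  case True
  then show ?thesis by (simp add: primes_upto_less_2)
next
  case False
  define N where "N = nat \<lfloor>x\<rfloor>"
  have N: "N \<ge> 1" using False by (simp add: N_def le_nat_iff le_floor_iff)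
  have "primes_upto x \<subseteq> {2..N}"
    using primes_upto_subset[of x] by (auto simp: N_def primes_upto_def prime_ge_2_nat)
  then have "(\<Sum>p\<in>primes_upto x. ln (real p) / (real p * (real p - 1)))
      \<le> (\<Sum>n=2..N. ln (real n) / (real n * (real n - 1)))"
    by (intro sum_mono2) auto
  also have "\<dots> \<le> 2 - (ln (real N) + 2) / real N" by (rule sum_ln_div_le[OF N])
  also have "\<dots> \<le> 2" using N by simp
  finally show ?thesis .
qed

lemma sum_ln_div_primes_upto_ge:
  assumes "N > 0"
  shows "ln (real N) - 3 \<le> (\<Sum>p\<in>primes_upto (real N). ln (real p) / real p)"
proof -
  have "real N * (ln (real N) - 1) \<le> ln (fact N)"
    using ln_fact_ge[of N] by (simp add: algebra_simps)
  also have "\<dots> \<le> (\<Sum>d=1..N. mangoldt d * (real N / real d))"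
    unfolding ln_fact_eq_sum_mangoldt
    by (intro sum_mono mult_left_mono of_nat_div_le_of_nat mangoldt_nonneg)
  also have "\<dots> = real N * (\<Sum>d=1..N. mangoldt d / real d)"
    by (simp add: sum_distrib_left mult.commute)
  finally have "ln (real N) - 1 \<le> (\<Sum>d=1..N. mangoldt d / real d)"
    using assms by simp
  also have "\<dots> \<le> (\<Sum>p\<in>primes_upto (real N). ln (real p) / (real p - 1))"
    by (rule sum_mangoldt_div_le)
  also have "\<dots> = (\<Sum>p\<in>primes_upto (real N). ln (real p) / real p + ln (real p) / (real p * (real p - 1)))"
    by (intro sum.cong) (auto simp: primes_upto_def field_simps dest: prime_gt_1_nat)
  also have "\<dots> \<le> (\<Sum>p\<in>primes_upto (real N). ln (real p) / real p) + 2"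
    unfolding sum.distrib by (intro add_left_mono sum_primes_upto_ln_div_le)
  finally show ?thesis by simp
qed

lemma sum_ln_div_primes_upto_le:
  assumes "N > 0"
  shows "(\<Sum>p\<in>primes_upto (real N). ln (real p) / real p) \<le> ln (real N) + 3"
proof -
  have "(\<Sum>p\<in>primes_upto (real N). ln (real p) * (real N / real p - 1))
      \<le> (\<Sum>p\<in>primes_upto (real N). mangoldt p * real (N div p))"
  proof (rule sum_mono)
    fix p assume "p \<in> primes_upto (real N)"
    then have p: "prime p" by (rule primes_upto_imp_prime)
    have "real N / real p - 1 \<le> real (N div p)"
      using real_of_int_div3[of "int N" "int p"] by (simp flip: of_nat_div)
    then show "ln (real p) * (real N / real p - 1) \<le> mangoldt p * real (N div p)"
      using p prime_gt_0_nat[OF p] by (auto intro!: mult_left_mono)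
  qed
  also have "\<dots> \<le> (\<Sum>d=1..N. mangoldt d * real (N div d))"
    using primes_upto_subset[of "real N"] by (intro sum_mono2) (auto simp: mangoldt_nonneg)
  also have "\<dots> \<le> real N * ln (real N)"
    using ln_fact_le by (simp add: ln_fact_eq_sum_mangoldt)
  finally have "real N * (\<Sum>p\<in>primes_upto (real N). ln (real p) / real p)
      \<le> real N * ln (real N) + (\<Sum>p\<in>primes_upto (real N). ln (real p))"
    by (simp add: algebra_simps sum_distrib_left sum_subtractf)
  also have "(\<Sum>p\<in>primes_upto (real N). ln (real p)) \<le> real N * 3"
  proof -
    have "4 * ln 2 * (real N - 1) \<le> 3 * real N"
      using assms ln2_le_25_over_36 by (intro mult_mono) auto
    then show ?thesis using sum_ln_primes_upto_le[OF assms] by simp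
  qed
  finally show ?thesis using assms by (simp flip: distrib_left)
qed

theorem mertens_first:
  "N > 0 \<Longrightarrow> \<bar>(\<Sum>p\<in>primes_upto (real N). ln (real p) / real p) - ln (real N)\<bar> \<le> 3"
  using sum_ln_div_primes_upto_ge[of N] sum_ln_div_primes_upto_le[of N] by linarith

subsection \<open>Growth of the logarithm of the Euler product\<close>

definition log_euler_factor :: "nat \<Rightarrow> real" where
  "log_euler_factor p = - ln (1 - 1 / real p)"

definition log_euler_product :: "real \<Rightarrow> real" where
  "log_euler_product x = (\<Sum>p\<in>primes_upto x. log_euler_factor p)"

lemma
  assumes "prime p"
  shows log_euler_factor_ge: "1 / real p \<le> log_euler_factor p"
    and log_euler_factor_le: "log_euler_factor p \<le> 1 / (real p - 1)"
proof -
  have p: "real p > 1" using prime_gt_1_nat[OF assms] by simp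
  show "1 / real p \<le> log_euler_factor p"
    using p ln_one_minus_pos_upper_bound[of "1 / real p"] by (simp add: log_euler_factor_def)
  have "log_euler_factor p \<le> (1 / real p) / (1 - 1 / real p)"
    using p ln_diff_le[of 1 "1 - 1 / real p"] by (simp add: log_euler_factor_def)
  also have "\<dots> = 1 / (real p - 1)"
    using p by (simp add: field_simps)
  finally show "log_euler_factor p \<le> 1 / (real p - 1)" .
qed

lemma log_euler_factor_nonneg: "prime p \<Longrightarrow> 0 \<le> log_euler_factor p"
  using log_euler_factor_ge[of p] by (rule order_trans[rotated]) auto

lemma log_euler_product_nonneg: "0 \<le> log_euler_product x"
  unfolding log_euler_product_def by (intro sum_nonneg log_euler_factor_nonneg primes_upto_imp_prime)

lemma log_euler_product_nat_floor:
  "x \<ge> 0 \<Longrightarrow> log_euler_product (real (nat \<lfloor>x\<rfloor>)) = log_euler_product x"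
  by (simp only: log_euler_product_def primes_upto_nat_floor)

lemma abel_sum_lower_bound:
  fixes f s :: "nat \<Rightarrow> real"
  assumes "m \<le> n"
    and "\<And>k. m \<le> k \<Longrightarrow> k \<le> n \<Longrightarrow> b \<le> s k"
    and "\<And>k. m \<le> k \<Longrightarrow> k < n \<Longrightarrow> f (Suc k) \<le> f k"
  shows "(s n - b) * f n - (s m - b) * f m \<le> (\<Sum>k=m..<n. (s (Suc k) - s k) * f (Suc k))"
  using assms
proof (induction n rule: dec_induct)
  case (step n)
  have "(s n - b) * f (Suc n) \<le> (s n - b) * f n"
    using step by (intro mult_left_mono) auto
  then have "(s (Suc n) - b) * f (Suc n) \<le> (s n - b) * f n + (s (Suc n) - s n) * f (Suc n)"
    by (simp add: algebra_simps)
  with step show ?case by (simp add: algebra_simps)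
qed simp

lemma ln_ln_diff_le_sum:
  assumes "2 \<le> m" "m \<le> n"
  shows "ln (ln (real n)) - ln (ln (real m)) - 1 / ln (real m)
    \<le> (\<Sum>k=m..<n. (ln (real (Suc k)) - ln (real k)) / ln (real (Suc k)))"
proof -
  define F where "F k = ln (ln (real k)) + 1 / ln (real k)" for k :: nat
  have "F n - F m = (\<Sum>k=m..<n. F (Suc k) - F k)"
    using assms(2) by (simp add: sum_Suc_diff')
  also have "\<dots> \<le> (\<Sum>k=m..<n. (ln (real (Suc k)) - ln (real k)) / ln (real (Suc k)))"
  proof (rule sum_mono)
    fix k assume "k \<in> {m..<n}"
    then have k: "k \<ge> 2" using assms by simp
    define u v where "u = ln (real k)" and "v = ln (real (Suc k))"
    have uv: "0 < u" "u \<le> v" using k by (simp_all add: u_def v_def)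
    have "v - u \<le> 1 / real k"
      using k ln_diff_le[of "real (Suc k)" "real k"] by (simp add: u_def v_def)
    also have "\<dots> \<le> 1" using k by simp
    finally have "(v - u) * (1 / u - 1 / v) \<le> 1 * (1 / u - 1 / v)"
      using uv by (intro mult_right_mono) (auto simp: frac_le)
    moreover have "ln v - ln u \<le> (v - u) / u"
      using uv by (intro ln_diff_le) auto
    ultimately have "(ln v + 1 / v) - (ln u + 1 / u) \<le> (v - u) / v"
      by (simp add: right_diff_distrib)
    then show "F (Suc k) - F k \<le> (ln (real (Suc k)) - ln (real k)) / ln (real (Suc k))"
      by (simp add: F_def u_def v_def)
  qed
  finally have "F n - F m \<le> (\<Sum>k=m..<n. (ln (real (Suc k)) - ln (real k)) / ln (real (Suc k)))" .
  moreover have "1 / ln (real n) \<ge> 0" using assms by simp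
  ultimately show ?thesis unfolding F_def by linarith
qed

lemma ln_ln_diff_le_weighted_sum:
  assumes s: "\<And>k. k > 0 \<Longrightarrow> \<bar>s k - ln (real k)\<bar> \<le> K"
    and mn: "2 \<le> m" "m \<le> n"
  shows "ln (ln (real n)) - ln (ln (real m)) - (2 * K + 1) / ln (real m)
    \<le> (\<Sum>k=m..<n. (s (Suc k) - s k) / ln (real (Suc k)))"
proof -
  define r where "r k = s k - ln (real k)" for k :: nat
  have r: "- K \<le> r k" "r k \<le> K" if "k > 0" for k
    using s[OF that] by (auto simp: r_def abs_le_iff)
  have "- (2 * K / ln (real m)) \<le> (r n + K) / ln (real n) - (r m + K) / ln (real m)"
  proof -
    have "0 \<le> (r n + K) / ln (real n)"
      using r(1)[of n] mn by (intro divide_nonneg_nonneg) auto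
    moreover have "(r m + K) / ln (real m) \<le> 2 * K / ln (real m)"
      using r(2)[of m] mn by (intro divide_right_mono) auto
    ultimately show ?thesis by linarith
  qed
  also have "\<dots> \<le> (\<Sum>k=m..<n. (r (Suc k) - r k) / ln (real (Suc k)))"
    using abel_sum_lower_bound[of m n "- K" r "\<lambda>k. 1 / ln (real k)"] mn r
    by (simp add: frac_le)
  also have "\<dots> = (\<Sum>k=m..<n. (s (Suc k) - s k) / ln (real (Suc k)))
      - (\<Sum>k=m..<n. (ln (real (Suc k)) - ln (real k)) / ln (real (Suc k)))"
    by (simp add: r_def diff_divide_distrib sum_subtractf)
  finally show ?thesis
    using ln_ln_diff_le_sum[OF mn] by (simp add: add_divide_distrib)
qed

theorem log_euler_product_increment_ge:
  assumes "2 \<le> m" "m \<le> n"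
  shows "log_euler_product (real m) - ln (ln (real m)) - 7 / ln (real m)
    \<le> log_euler_product (real n) - ln (ln (real n))"
proof -
  define s where "s k = (\<Sum>p\<in>primes_upto (real k). ln (real p) / real p)" for k :: nat
  have "ln (ln (real n)) - ln (ln (real m)) - (2 * 3 + 1) / ln (real m)
      \<le> (\<Sum>k=m..<n. (s (Suc k) - s k) / ln (real (Suc k)))"
    using assms mertens_first by (intro ln_ln_diff_le_weighted_sum) (auto simp: s_def)
  also have "\<dots> \<le> (\<Sum>k=m..<n. log_euler_product (real (Suc k)) - log_euler_product (real k))"
  proof (rule sum_mono)
    fix k assume k: "k \<in> {m..<n}"
    then have "(s (Suc k) - s k) / ln (real (Suc k)) = (if prime (Suc k) then 1 / real (Suc k) else 0)"
      using assms unfolding s_def sum_primes_upto_Suc by simp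
    also have "\<dots> \<le> (if prime (Suc k) then log_euler_factor (Suc k) else 0)"
      by (simp add: log_euler_factor_ge del: of_nat_Suc)
    also have "\<dots> = log_euler_product (real (Suc k)) - log_euler_product (real k)"
      unfolding log_euler_product_def sum_primes_upto_Suc by simp
    finally show "(s (Suc k) - s k) / ln (real (Suc k))
        \<le> log_euler_product (real (Suc k)) - log_euler_product (real k)" .
  qed
  also have "\<dots> = log_euler_product (real n) - log_euler_product (real m)"
    using assms(2) by (rule sum_Suc_diff')
  finally show ?thesis by simp
qed

subsection \<open>Euler products over \<open>t\<close>-free smooth numbers\<close>

lemma t_free_iff_multiplicity_less:
  assumes "n > 0"
  shows "t_free t n \<longleftrightarrow> (\<forall>p. prime p \<longrightarrow> multiplicity p n < t)"
proof -
  have "p ^ t dvd n \<longleftrightarrow> t \<le> multiplicity p n" if "prime p" for p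
    using assms that by (intro power_dvd_iff_le_multiplicity) (auto dest: prime_gt_1_nat)
  then show ?thesis by (auto simp: t_free_def not_le)
qed

definition t_free_smooth :: "nat set \<Rightarrow> nat \<Rightarrow> nat set" where
  "t_free_smooth P t = {n. n > 0 \<and> prime_factors n \<subseteq> P \<and> t_free t n}"

lemma bij_betw_t_free_smooth:
  fixes P :: "nat set"
  assumes "finite P" "\<And>p. p \<in> P \<Longrightarrow> prime p" "t > 0"
  shows "bij_betw (\<lambda>e. \<Prod>p\<in>P. p ^ e p) (P \<rightarrow>\<^sub>E {..<t}) (t_free_smooth P t)"
proof (rule bij_betw_byWitness[where f' = "\<lambda>n. \<lambda>p\<in>P. multiplicity p n"])
  let ?F = "\<lambda>e. \<Prod>p\<in>P. p ^ e p"
  have mult: "multiplicity q (?F e) = (if q \<in> P then e q else 0)" if "prime q" for q e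
    using assms that by (intro multiplicity_prod_prime_powers) auto
  have pos: "?F e > 0" for e
    using assms by (auto intro!: prod_pos dest: prime_gt_0_nat)
  show "\<forall>e\<in>P \<rightarrow>\<^sub>E {..<t}. (\<lambda>p\<in>P. multiplicity p (?F e)) = e"
    using mult assms by (auto simp: restrict_def PiE_def extensional_def fun_eq_iff)
  show "\<forall>n\<in>t_free_smooth P t. ?F (\<lambda>p\<in>P. multiplicity p n) = n"
  proof
    fix n assume n: "n \<in> t_free_smooth P t"
    have "?F (\<lambda>p\<in>P. multiplicity p n) = (\<Prod>p\<in>P. p ^ multiplicity p n)" by simp
    also have "\<dots> = (\<Prod>p\<in>prime_factors n. p ^ multiplicity p n)"
      using n assms by (intro prod.mono_neutral_right) (auto simp: t_free_smooth_def prime_factors_multiplicity)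
    also have "\<dots> = n"
      using n by (simp add: t_free_smooth_def prime_factorization_nat[symmetric])
    finally show "?F (\<lambda>p\<in>P. multiplicity p n) = n" .
  qed
  show "?F ` (P \<rightarrow>\<^sub>E {..<t}) \<subseteq> t_free_smooth P t"
    using assms(3) pos
    by (auto simp: t_free_smooth_def t_free_iff_multiplicity_less mult prime_factors_multiplicity split: if_splits)
  show "(\<lambda>n. \<lambda>p\<in>P. multiplicity p n) ` t_free_smooth P t \<subseteq> P \<rightarrow>\<^sub>E {..<t}"
    using assms(2) by (auto simp: t_free_smooth_def t_free_iff_multiplicity_less)
qed

lemma finite_t_free_smooth:
  assumes "finite P" "\<And>p. p \<in> P \<Longrightarrow> prime p" "t > 0"
  shows "finite (t_free_smooth P t)"
  using bij_betw_finite[OF bij_betw_t_free_smooth[OF assms]] finite_PiE[OF assms(1), of "\<lambda>_. {..<t}"] by simp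

lemma prod_sum_power_eq_sum_t_free_smooth:
  fixes f :: "nat \<Rightarrow> 'a :: comm_semiring_1"
  assumes P: "finite P" "\<And>p. p \<in> P \<Longrightarrow> prime p" and "t > 0"
    and f_one: "f 1 = 1" and f_mult: "\<And>m n. f (m * n) = f m * f n"
  shows "(\<Prod>p\<in>P. \<Sum>j<t. f p ^ j) = (\<Sum>n\<in>t_free_smooth P t. f n)"
proof -
  have f_power: "f (n ^ k) = f n ^ k" for n k
    using f_one by (induction k) (auto simp: f_mult)
  have f_prod: "f (\<Prod>p\<in>B. h p) = (\<Prod>p\<in>B. f (h p))" for B and h :: "nat \<Rightarrow> nat"
    using f_one by (induction B rule: infinite_finite_induct) (auto simp: f_mult)
  have "(\<Prod>p\<in>P. \<Sum>j<t. f p ^ j) = (\<Sum>e\<in>P \<rightarrow>\<^sub>E {..<t}. \<Prod>p\<in>P. f p ^ e p)"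
    using P(1) by (intro prod_sum_PiE) auto
  also have "\<dots> = (\<Sum>e\<in>P \<rightarrow>\<^sub>E {..<t}. f (\<Prod>p\<in>P. p ^ e p))"
    by (simp add: f_prod f_power)
  also have "\<dots> = (\<Sum>n\<in>t_free_smooth P t. f n)"
    by (rule sum.reindex_bij_betw[OF bij_betw_t_free_smooth[OF P \<open>t > 0\<close>]])
  finally show ?thesis .
qed

subsection \<open>Mertens' third theorem\<close>

lemma mult_powr_Suc_le_powr_diff:
  fixes \<delta> x :: real
  assumes "\<delta> > 0" "x > 0"
  shows "\<delta> * (x + 1) powr - (1 + \<delta>) \<le> x powr - \<delta> - (x + 1) powr - \<delta>"
proof -
  have "1 + \<delta> * (1 / (x + 1)) \<le> 1 + \<delta> * (ln (x + 1) - ln x)"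
    using assms ln_diff_le[of x "x + 1"] by (intro add_left_mono mult_left_mono) (auto simp: field_simps)
  also have "\<dots> \<le> exp (\<delta> * (ln (x + 1) - ln x))"
    by (rule exp_ge_add_one_self)
  finally have "exp (- \<delta> * ln (x + 1)) * (1 + \<delta> * (1 / (x + 1)))
      \<le> exp (- \<delta> * ln (x + 1)) * exp (\<delta> * (ln (x + 1) - ln x))"
    by (intro mult_left_mono) auto
  also have "\<dots> = x powr - \<delta>"
    using assms by (simp add: powr_def algebra_simps flip: exp_add)
  finally have "(x + 1) powr - \<delta> + \<delta> * ((x + 1) powr - \<delta> / (x + 1)) \<le> x powr - \<delta>"
    using assms by (simp add: powr_def algebra_simps)
  moreover have "(x + 1) powr - (1 + \<delta>) = (x + 1) powr - \<delta> / (x + 1)"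
    using assms by (simp add: powr_diff powr_minus_divide)
  ultimately show ?thesis by simp
qed

lemma sum_powr_le:
  fixes \<delta> :: real
  assumes "\<delta> > 0" "N > 0"
  shows "(\<Sum>n=1..N. real n powr - (1 + \<delta>)) \<le> 1 + (1 - real N powr - \<delta>) / \<delta>"
  using assms(2)
proof (induction N rule: nat_induct_non_zero)
  case (Suc N)
  have "real (Suc N) powr - (1 + \<delta>) \<le> (real N powr - \<delta> - real (Suc N) powr - \<delta>) / \<delta>"
    using mult_powr_Suc_le_powr_diff[OF assms(1), of "real N"] Suc.hyps assms(1)
    by (simp add: pos_le_divide_eq mult.commute add.commute)
  with Suc.IH show ?case by (simp add: diff_divide_distrib)
qed simp

lemma prod_sum_power_powr_primes_upto_le:
  fixes \<delta> :: real
  assumes "\<delta> > 0" "t > 0"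
  shows "(\<Prod>p\<in>primes_upto x. \<Sum>j<t. (real p powr - (1 + \<delta>)) ^ j) \<le> 1 + 1 / \<delta>"
proof -
  define A where "A = t_free_smooth (primes_upto x) t"
  have "finite A"
    unfolding A_def using assms(2) by (intro finite_t_free_smooth) (auto dest: primes_upto_imp_prime)
  then obtain N where "A \<subseteq> {..N}"
    by (auto simp: finite_nat_set_iff_bounded_le)
  then have N: "A \<subseteq> {1..Suc N}"
    by (auto simp: A_def t_free_smooth_def Suc_le_eq intro: le_SucI)
  have "(\<Prod>p\<in>primes_upto x. \<Sum>j<t. (real p powr - (1 + \<delta>)) ^ j) = (\<Sum>n\<in>A. real n powr - (1 + \<delta>))"
    unfolding A_def using assms(2)
    by (intro prod_sum_power_eq_sum_t_free_smooth) (auto simp: powr_mult dest: primes_upto_imp_prime)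
  also have "\<dots> \<le> (\<Sum>n=1..Suc N. real n powr - (1 + \<delta>))"
    using N by (intro sum_mono2) auto
  also have "\<dots> \<le> 1 + (1 - real (Suc N) powr - \<delta>) / \<delta>"
    using assms(1) by (intro sum_powr_le) auto
  also have "\<dots> \<le> 1 + 1 / \<delta>"
    using assms(1) by (intro add_left_mono divide_right_mono) auto
  finally show ?thesis .
qed

lemma sum_neg_ln_one_minus_powr_primes_upto_le:
  fixes \<delta> :: real
  assumes "\<delta> > 0"
  shows "(\<Sum>p\<in>primes_upto x. - ln (1 - real p powr - (1 + \<delta>))) \<le> ln (1 + 1 / \<delta>)"
proof -
  define f where "f n = real n powr - (1 + \<delta>)" for n :: nat
  have f: "0 < f p" "f p < 1" if "p \<in> primes_upto x" for p
    using that assms by (auto simp: f_def primes_upto_def intro!: powr_less_one dest: prime_gt_1_nat)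
  have "(\<lambda>t. \<Prod>p\<in>primes_upto x. \<Sum>j<t. f p ^ j) \<longlonglongrightarrow> (\<Prod>p\<in>primes_upto x. 1 / (1 - f p))"
    using f by (intro tendsto_prod geometric_sums[unfolded sums_def]) (simp add: abs_of_pos)
  then have "(\<Prod>p\<in>primes_upto x. 1 / (1 - f p)) \<le> 1 + 1 / \<delta>"
    unfolding f_def
    by (rule LIMSEQ_le_const2)
       (use prod_sum_power_powr_primes_upto_le[OF assms] in \<open>auto intro!: exI[of _ 1]\<close>)
  then have "ln (\<Prod>p\<in>primes_upto x. 1 / (1 - f p)) \<le> ln (1 + 1 / \<delta>)"
    using f by (intro ln_mono prod_pos) auto
  moreover have "ln (\<Prod>p\<in>primes_upto x. 1 / (1 - f p)) = (\<Sum>p\<in>primes_upto x. - ln (1 - f p))"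
    using f by (subst ln_prod) (force simp: ln_div intro!: sum.cong)+
  ultimately show ?thesis
    by (simp add: f_def)
qed

\<comment> \<open>By convexity the graph of \<open>u \<mapsto> - ln (1 - q * u)\<close> lies above its tangent at \<open>u = 1\<close>.\<close>
lemma neg_ln_one_minus_mult_le:
  fixes q u :: real
  assumes "0 \<le> q" "q < 1" "0 \<le> u" "u \<le> 1"
  shows "- ln (1 - q) * u \<le> - ln (1 - q * u) + (1 - u) * (q / (1 - q) - q)"
proof -
  have "q * u < 1"
    using assms mult_left_le[of u q] by linarith
  then have "ln (1 - q * u) - ln (1 - q) \<le> (1 - u) * (q / (1 - q))"
    using assms ln_diff_le[of "1 - q * u" "1 - q"] by (simp add: algebra_simps)
  moreover have "(1 - u) * q \<le> (1 - u) * (- ln (1 - q))"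
    using assms ln_one_minus_pos_upper_bound[of q] by (intro mult_left_mono) auto
  ultimately show ?thesis by (simp add: algebra_simps)
qed

lemma log_euler_factor_mult_powr_le:
  fixes \<delta> :: real
  assumes "prime p" "\<delta> \<ge> 0"
  shows "log_euler_factor p * real p powr - \<delta>
    \<le> - ln (1 - real p powr - (1 + \<delta>)) + \<delta> * (ln (real p) / (real p * (real p - 1)))"
proof -
  have p: "real p > 1" using prime_gt_1_nat[OF assms(1)] by simp
  define u where "u = real p powr - \<delta>"
  have u: "0 \<le> u" "u \<le> 1"
    using p assms by (auto simp: u_def powr_minus ge_one_powr_ge_zero inverse_le_1_iff)
  have "1 - u \<le> \<delta> * ln (real p)"
    using p exp_ge_add_one_self[of "- \<delta> * ln (real p)"] by (simp add: u_def powr_def)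
  then have "(1 - u) * (1 / (real p * (real p - 1))) \<le> \<delta> * ln (real p) * (1 / (real p * (real p - 1)))"
    using p by (intro mult_right_mono) auto
  moreover have "log_euler_factor p * u
      \<le> - ln (1 - 1 / real p * u) + (1 - u) * (1 / real p / (1 - 1 / real p) - 1 / real p)"
    unfolding log_euler_factor_def using p u by (intro neg_ln_one_minus_mult_le) auto
  moreover have "1 / real p / (1 - 1 / real p) - 1 / real p = 1 / (real p * (real p - 1))"
    using p by (simp add: field_simps)
  moreover have "1 / real p * u = real p powr - (1 + \<delta>)"
    using p by (simp add: u_def powr_diff powr_minus_divide)
  ultimately show ?thesis by (simp add: u_def)
qed

lemma sum_log_euler_factor_powr_le:
  fixes \<delta> :: real
  assumes "\<delta> > 0"
  shows "(\<Sum>p\<in>primes_upto x. log_euler_factor p * real p powr - \<delta>) \<le> ln (1 + 1 / \<delta>) + 2 * \<delta>"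
proof -
  have "(\<Sum>p\<in>primes_upto x. log_euler_factor p * real p powr - \<delta>) \<le>
      (\<Sum>p\<in>primes_upto x. - ln (1 - real p powr - (1 + \<delta>)) + \<delta> * (ln (real p) / (real p * (real p - 1))))"
    using assms by (intro sum_mono log_euler_factor_mult_powr_le primes_upto_imp_prime) auto
  also have "\<dots> = (\<Sum>p\<in>primes_upto x. - ln (1 - real p powr - (1 + \<delta>)))
      + \<delta> * (\<Sum>p\<in>primes_upto x. ln (real p) / (real p * (real p - 1)))"
    by (simp only: sum.distrib sum_distrib_left)
  also have "\<dots> \<le> ln (1 + 1 / \<delta>) + \<delta> * 2"
    using assms
    by (intro add_mono sum_neg_ln_one_minus_powr_primes_upto_le mult_left_mono sum_primes_upto_ln_div_le) auto
  finally show ?thesis by simp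
qed

lemma sum_log_euler_product_exp_diff_le:
  fixes \<delta> :: real
  assumes "\<delta> \<ge> 0"
  shows "(\<Sum>k<n. (log_euler_product (exp (real (Suc k))) - log_euler_product (exp (real k))) * exp (- \<delta>) ^ Suc k)
    \<le> (\<Sum>p\<in>primes_upto (exp (real n)). log_euler_factor p * real p powr - \<delta>)"
proof (induction n)
  case 0
  show ?case by (simp add: primes_upto_less_2)
next
  case (Suc n)
  define D where "D = primes_upto (exp (real (Suc n))) - primes_upto (exp (real n))"
  have sum_eq: "sum h (primes_upto (exp (real (Suc n)))) = sum h D + sum h (primes_upto (exp (real n)))"
    for h :: "nat \<Rightarrow> real"
    unfolding D_def by (intro sum.subset_diff primes_upto_mono) auto
  have "(log_euler_product (exp (real (Suc n))) - log_euler_product (exp (real n))) * exp (- \<delta>) ^ Suc n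
      = (\<Sum>p\<in>D. log_euler_factor p * exp (- \<delta>) ^ Suc n)"
    by (simp only: log_euler_product_def sum_eq add_diff_cancel_right' sum_distrib_right)
  also have "\<dots> \<le> (\<Sum>p\<in>D. log_euler_factor p * real p powr - \<delta>)"
  proof (intro sum_mono mult_left_mono)
    fix p assume "p \<in> D"
    then have p: "prime p" "real p \<le> exp (real (Suc n))"
      by (auto simp: D_def primes_upto_def)
    then show "0 \<le> log_euler_factor p" by (intro log_euler_factor_nonneg)
    have "exp (- \<delta>) ^ Suc n = exp (real (Suc n)) powr - \<delta>"
      unfolding powr_def exp_of_nat_mult[symmetric] by simp
    also have "\<dots> \<le> real p powr - \<delta>"
      using p assms prime_gt_0_nat[OF p(1)] by (intro powr_mono2') auto
    finally show "exp (- \<delta>) ^ Suc n \<le> real p powr - \<delta>" .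
  qed
  finally show ?case using Suc by (simp add: sum_eq del: of_nat_Suc power_Suc)
qed

lemma sum_diff_mult_power_lower_bound:
  fixes s :: "nat \<Rightarrow> real"
  assumes "s 0 = 0" "\<And>k. - C \<le> s k" "\<And>k. k0 \<le> k \<Longrightarrow> \<eta> \<le> s k"
    and q: "0 \<le> q" "q \<le> 1" and n: "k0 \<le> n"
  shows "(C + \<eta>) * q ^ k0 - C \<le> (\<Sum>k<n. (s (Suc k) - s k) * q ^ Suc k)"
proof -
  have antimono: "q ^ Suc k \<le> q ^ k" for k
    using q by (intro power_decreasing) auto
  have "(s k0 + C) * q ^ k0 - C \<le> (\<Sum>k=0..<k0. (s (Suc k) - s k) * q ^ Suc k)"
    using abel_sum_lower_bound[of 0 k0 "- C" s "\<lambda>k. q ^ k"] assms(1,2) antimono by simp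
  moreover have "(s n - \<eta>) * q ^ n - (s k0 - \<eta>) * q ^ k0 \<le> (\<Sum>k=k0..<n. (s (Suc k) - s k) * q ^ Suc k)"
    using assms(3) n antimono by (intro abel_sum_lower_bound)
  moreover have "0 \<le> (s n - \<eta>) * q ^ n"
    using assms(3)[OF n] q by simp
  moreover have "(\<Sum>k<n. (s (Suc k) - s k) * q ^ Suc k) =
      (\<Sum>k=0..<k0. (s (Suc k) - s k) * q ^ Suc k) + (\<Sum>k=k0..<n. (s (Suc k) - s k) * q ^ Suc k)"
    using n by (simp add: sum.atLeastLessThan_concat lessThan_atLeast0)
  ultimately show ?thesis by (simp add: algebra_simps)
qed

lemma power_div_sums_neg_ln:
  fixes q :: real
  assumes "\<bar>q\<bar> < 1"
  shows "(\<lambda>k. q ^ Suc k / real (Suc k)) sums (- ln (1 - q))"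
proof -
  have "(\<lambda>k. - (- (q ^ k) / real k)) sums (- ln (1 - q))"
    using ln_series'[of "- q"] assms by (intro sums_minus) simp
  then show ?thesis
    by (subst sums_Suc_iff) simp
qed

lemma harm_excess_partial_sum_bound:
  fixes \<delta> \<eta> :: real
  defines "q \<equiv> exp (- \<delta>)"
  assumes excess: "\<And>k. k \<ge> k0 \<Longrightarrow> harm k + \<eta> \<le> log_euler_product (exp (real k))"
    and "- harm k0 \<le> \<eta>" "\<delta> > 0" "k0 \<le> n"
  shows "(harm k0 + \<eta>) * q ^ k0 - harm k0 + (\<Sum>k<n. q ^ Suc k / real (Suc k)) \<le> ln (1 + 1 / \<delta>) + 2 * \<delta>"
proof -
  define L where "L k = log_euler_product (exp (real k))" for k :: nat
  define s where "s k = L k - harm k" for k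
  have s_ge: "\<eta> \<le> s k" if "k0 \<le> k" for k
    using excess[OF that] by (simp add: s_def L_def)
  have "(harm k0 + \<eta>) * q ^ k0 - harm k0 \<le> (\<Sum>k<n. (s (Suc k) - s k) * q ^ Suc k)"
  proof (rule sum_diff_mult_power_lower_bound)
    show "s 0 = 0" by (simp add: s_def L_def log_euler_product_def primes_upto_less_2 harm_def)
    show "- harm k0 \<le> s k" for k
    proof (cases "k0 \<le> k")
      case True
      then show ?thesis using s_ge[of k] assms(3) by simp
    next
      case False
      then show ?thesis
        using harm_mono[of k k0, where ?'a = real] log_euler_product_nonneg[of "exp (real k)"]
        by (simp add: s_def L_def)
    qed
  qed (use s_ge assms in auto)
  also have "\<dots> = (\<Sum>k<n. (L (Suc k) - L k) * q ^ Suc k) - (\<Sum>k<n. q ^ Suc k / real (Suc k))"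
    by (simp add: s_def harm_Suc divide_inverse algebra_simps flip: sum_subtractf)
  also have "(\<Sum>k<n. (L (Suc k) - L k) * q ^ Suc k) \<le> ln (1 + 1 / \<delta>) + 2 * \<delta>"
    unfolding L_def q_def using assms(4)
    by (intro order_trans[OF sum_log_euler_product_exp_diff_le sum_log_euler_factor_powr_le]) auto
  finally show ?thesis by simp
qed

lemma harm_excess_abel_bound:
  fixes \<delta> \<eta> :: real
  assumes "\<And>k. k \<ge> k0 \<Longrightarrow> harm k + \<eta> \<le> log_euler_product (exp (real k))"
    and "- harm k0 \<le> \<eta>" "\<delta> > 0"
  shows "(harm k0 + \<eta>) * exp (- \<delta>) ^ k0 - harm k0 - ln (1 - exp (- \<delta>)) \<le> ln (1 + 1 / \<delta>) + 2 * \<delta>"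
proof (rule LIMSEQ_le_const2)
  define q where "q = exp (- \<delta>)"
  have "\<bar>q\<bar> < 1" using assms(3) by (simp add: q_def)
  then have "(\<lambda>n. (harm k0 + \<eta>) * q ^ k0 - harm k0 + (\<Sum>k<n. q ^ Suc k / real (Suc k)))
      \<longlonglongrightarrow> (harm k0 + \<eta>) * q ^ k0 - harm k0 + - ln (1 - q)"
    by (intro tendsto_add tendsto_const power_div_sums_neg_ln[unfolded sums_def])
  then show "(\<lambda>n. (harm k0 + \<eta>) * q ^ k0 - harm k0 + (\<Sum>k<n. q ^ Suc k / real (Suc k)))
      \<longlonglongrightarrow> (harm k0 + \<eta>) * exp (- \<delta>) ^ k0 - harm k0 - ln (1 - exp (- \<delta>))"
    by (simp add: q_def)
  show "\<exists>N. \<forall>n\<ge>N. (harm k0 + \<eta>) * q ^ k0 - harm k0 + (\<Sum>k<n. q ^ Suc k / real (Suc k))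
      \<le> ln (1 + 1 / \<delta>) + 2 * \<delta>"
    unfolding q_def using harm_excess_partial_sum_bound[OF assms] by blast
qed

lemma eventually_harm_le_log_euler_product_imp_nonpos:
  fixes \<eta> :: real
  assumes "eventually (\<lambda>k. harm k + \<eta> \<le> log_euler_product (exp (real k))) sequentially"
  shows "\<eta> \<le> 0"
proof (cases "\<eta> \<ge> 0")
  case True
  obtain k0 where k0: "\<And>k. k \<ge> k0 \<Longrightarrow> harm k + \<eta> \<le> log_euler_product (exp (real k))"
    using assms by (auto simp: eventually_sequentially)
  define C where "C = (harm k0 :: real)"
  have "- C \<le> \<eta>"
    using True harm_nonneg[of k0, where ?'a = real] by (simp add: C_def)
  let ?g = "\<lambda>\<delta>. (C + \<eta>) * exp (- \<delta>) ^ k0 - C + (- ln (1 - exp (- \<delta>)) - ln (1 + 1 / \<delta>)) - 2 * \<delta>"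
  have "(?g \<longlongrightarrow> (C + \<eta>) * exp (- 0) ^ k0 - C + 0 - 2 * 0) (at_right 0)"
  proof (intro tendsto_intros)
    show "((\<lambda>\<delta>::real. - ln (1 - exp (- \<delta>)) - ln (1 + 1 / \<delta>)) \<longlongrightarrow> 0) (at_right 0)"
      by real_asymp
  qed
  then have "(?g \<longlongrightarrow> \<eta>) (at_right 0)"
    by simp
  moreover have "eventually (\<lambda>\<delta>. ?g \<delta> \<le> 0) (at_right 0)"
    using eventually_at_right_less[of "0::real"]
  proof eventually_elim
    case (elim \<delta>)
    show ?case using harm_excess_abel_bound[of k0 \<eta> \<delta>, OF k0] elim \<open>- C \<le> \<eta>\<close> by (simp add: C_def)
  qed
  ultimately show ?thesis
    by (rule tendsto_upperbound) simp
qed simp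

lemma log_euler_product_le_of_nat:
  assumes "m \<ge> 2"
  shows "log_euler_product (real m) \<le> ln (ln (real m)) + euler_mascheroni + 7 / ln (real m)"
proof -
  define \<eta> where "\<eta> = log_euler_product (real m) - ln (ln (real m)) - 7 / ln (real m) - euler_mascheroni"
  have "\<eta> - \<epsilon> \<le> 0" if "\<epsilon> > 0" for \<epsilon>
  proof (rule eventually_harm_le_log_euler_product_imp_nonpos)
    have "(\<lambda>k. (harm k - ln (real k)) + (ln (real k) - ln (ln (exp (real k) - 1)))) \<longlonglongrightarrow> euler_mascheroni + 0"
      by (intro tendsto_add euler_mascheroni_LIMSEQ) real_asymp
    then have "eventually (\<lambda>k. (harm k - ln (real k)) + (ln (real k) - ln (ln (exp (real k) - 1)))
        < euler_mascheroni + \<epsilon>) sequentially"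
      using that by (intro order_tendstoD) auto
    moreover have "eventually (\<lambda>k. exp (real k) - 1 > real m) sequentially"
      by real_asymp
    ultimately show "eventually (\<lambda>k. harm k + (\<eta> - \<epsilon>) \<le> log_euler_product (exp (real k))) sequentially"
    proof eventually_elim
      case (elim k)
      define n where "n = nat \<lfloor>exp (real k)\<rfloor>"
      have n: "exp (real k) - 1 \<le> real n" unfolding n_def by linarith
      have "0 < ln (exp (real k) - 1)"
        using elim assms by (intro ln_gt_zero) linarith
      then have "ln (ln (exp (real k) - 1)) \<le> ln (ln (real n))"
        using elim assms n by (intro ln_mono) linarith+
      moreover have "log_euler_product (exp (real k)) = log_euler_product (real n)"
        unfolding n_def by (rule log_euler_product_nat_floor[symmetric]) simp
      moreover have "\<eta> + euler_mascheroni \<le> log_euler_product (real n) - ln (ln (real n))"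
        using log_euler_product_increment_ge[of m n] assms elim n by (simp add: \<eta>_def)
      ultimately show ?case using elim by linarith
    qed
  qed
  then have "\<eta> \<le> 0"
    using field_le_epsilon[of \<eta> 0] by simp
  then show ?thesis by (simp add: \<eta>_def)
qed

theorem mertens_third_upper:
  assumes "x \<ge> 2"
  shows "log_euler_product x \<le> ln (ln x) + euler_mascheroni + 14 / ln x"
proof -
  define n where "n = nat \<lfloor>x\<rfloor>"
  have n: "n \<ge> 2" "real n \<le> x" "x \<le> real n + 1"
    using assms by (simp_all add: n_def le_nat_iff le_floor_iff)
  have "x \<le> 2 * real n"
    using n by simp
  also have "\<dots> \<le> real n ^ 2"
    unfolding power2_eq_square using n by (intro mult_right_mono) auto
  finally have "ln x \<le> ln (real n ^ 2)"
    using assms by (intro ln_mono) auto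
  then have "7 / ln (real n) \<le> 7 / (ln x / 2)"
    using n assms by (intro divide_left_mono) (auto simp: ln_realpow)
  moreover have "ln (ln (real n)) \<le> ln (ln x)"
    using n by (intro ln_mono) auto
  moreover have "log_euler_product x = log_euler_product (real n)"
    unfolding n_def using assms by (intro log_euler_product_nat_floor[symmetric]) simp
  ultimately show ?thesis
    using log_euler_product_le_of_nat[OF n(1)] by simp
qed

subsection \<open>Robin's inequality for \<open>t\<close>-free integers\<close>

lemma divisor_sigma_div_eq:
  assumes "m > 0"
  shows "real (divisor_sigma m) / real m = (\<Sum>d | d dvd m. 1 / real d)"
proof -
  have "real (divisor_sigma m) / real m = (\<Sum>d | d dvd m. real d / real m)"
    by (simp add: divisor_sigma_def sum_divide_distrib)
  also have "\<dots> = (\<Sum>d | d dvd m. 1 / real d)"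
    by (rule sum.reindex_bij_witness[of _ "\<lambda>d. m div d" "\<lambda>d. m div d"])
       (use assms in \<open>auto simp: real_of_nat_div\<close>)
  finally show ?thesis .
qed

lemma divisor_sigma_div_le_prod:
  assumes "S > 0" "t_free t S" "t > 0"
  shows "real (divisor_sigma S) / real S \<le> (\<Prod>p\<in>prime_factors S. \<Sum>j<t. (1 / real p) ^ j)"
proof -
  have "{d. d dvd S} \<subseteq> t_free_smooth (prime_factors S) t"
    using assms dvd_prime_factors[of S]
    by (auto simp: t_free_smooth_def t_free_def intro!: Nat.gr0I dest: dvd_trans)
  then have "(\<Sum>d | d dvd S. 1 / real d) \<le> (\<Sum>d\<in>t_free_smooth (prime_factors S) t. 1 / real d)"
    using assms(3) by (intro sum_mono2 finite_t_free_smooth) auto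
  also have "\<dots> = (\<Prod>p\<in>prime_factors S. \<Sum>j<t. (1 / real p) ^ j)"
    using assms(3) by (intro prod_sum_power_eq_sum_t_free_smooth[symmetric]) auto
  finally show ?thesis by (simp add: divisor_sigma_div_eq[OF assms(1)])
qed

lemma sum_power_inverse_prime_eq:
  assumes "prime p"
  shows "(\<Sum>j<t. (1 / real p) ^ j) = (1 - (1 / real p) ^ t) * exp (log_euler_factor p)"
proof -
  have "real p > 1" using prime_gt_1_nat[OF assms] by simp
  then show ?thesis
    by (subst sum_gp_strict) (auto simp: log_euler_factor_def exp_minus divide_inverse[of "1 - _"])
qed

lemma sum_power_inverse_prime_le:
  assumes "prime p"
  shows "(\<Sum>j<t. (1 / real p) ^ j) \<le> exp (log_euler_factor p)"
  unfolding sum_power_inverse_prime_eq[OF assms]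
  using prime_gt_0_nat[OF assms] by (intro mult_left_le_one_le) (auto simp: power_le_one)

lemma prod_sum_power_inverse_primes_upto_le:
  assumes "x \<ge> 2"
  shows "(\<Prod>p\<in>primes_upto x. \<Sum>j<t. (1 / real p) ^ j) \<le> (1 - (1 / 2) ^ t) * exp (log_euler_product x)"
proof -
  let ?h = "\<lambda>p. \<Sum>j<t. (1 / real p) ^ j"
  have two: "2 \<in> primes_upto x" using assms by (simp add: primes_upto_def)
  have "prod ?h (primes_upto x) = ?h 2 * prod ?h (primes_upto x - {2})"
    using two by (simp add: prod.remove)
  also have "\<dots> \<le> ?h 2 * (\<Prod>p\<in>primes_upto x - {2}. exp (log_euler_factor p))"
    by (intro mult_left_mono prod_mono)
       (auto intro!: sum_nonneg sum_power_inverse_prime_le dest: primes_upto_imp_prime)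
  also have "\<dots> = (1 - (1 / 2) ^ t) * (\<Prod>p\<in>primes_upto x. exp (log_euler_factor p))"
    using two sum_power_inverse_prime_eq[of 2 t] by (simp add: prod.remove)
  also have "\<dots> = (1 - (1 / 2) ^ t) * exp (log_euler_product x)"
    by (simp add: log_euler_product_def exp_sum)
  finally show ?thesis .
qed

lemma card_prime_factors_greater_le:
  assumes "S > 0" "y > 1"
  shows "real (card {p \<in> prime_factors S. y < real p}) \<le> ln (real S) / ln y"
proof -
  let ?Q = "{p \<in> prime_factors S. y < real p}"
  have "real (card ?Q) * ln y = (\<Sum>p\<in>?Q. ln y)" by simp
  also have "\<dots> \<le> (\<Sum>p\<in>?Q. ln (real p))"
    using assms(2) by (intro sum_mono ln_mono) auto
  also have "\<dots> \<le> ln (real S)"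
    using assms(1) by (intro sum_ln_prime_factors_le) auto
  finally show ?thesis using assms(2) by (simp add: pos_le_divide_eq)
qed

lemma sum_log_euler_factor_prime_factors_greater_le:
  assumes "S > 0" "y > 1"
  shows "(\<Sum>p | p \<in> prime_factors S \<and> y < real p. log_euler_factor p) \<le> ln (real S) / ((y - 1) * ln y)"
proof -
  let ?Q = "{p \<in> prime_factors S. y < real p}"
  have "(\<Sum>p\<in>?Q. log_euler_factor p) \<le> (\<Sum>p\<in>?Q. 1 / (y - 1))"
  proof (rule sum_mono)
    fix p assume "p \<in> ?Q"
    then have p: "prime p" "y < real p" by auto
    have "log_euler_factor p \<le> 1 / (real p - 1)" using p(1) by (rule log_euler_factor_le)
    also have "\<dots> \<le> 1 / (y - 1)" using p assms(2) by (intro frac_le) auto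
    finally show "log_euler_factor p \<le> 1 / (y - 1)" .
  qed
  also have "\<dots> = real (card ?Q) * (1 / (y - 1))" by simp
  also have "\<dots> \<le> ln (real S) / ln y * (1 / (y - 1))"
    using assms by (intro mult_right_mono card_prime_factors_greater_le) auto
  finally show ?thesis by (simp add: mult.commute)
qed

lemma prod_prime_factors_le:
  assumes "S > 0" "t > 0" "x \<ge> 2"
  shows "(\<Prod>p\<in>prime_factors S. \<Sum>j<t. (1 / real p) ^ j)
    \<le> (1 - (1 / 2) ^ t) * exp (log_euler_product x + ln (real S) / ((x - 1) * ln x))"
proof -
  let ?h = "\<lambda>p. \<Sum>j<t. (1 / real p) ^ j"
  define Q where "Q = {p \<in> prime_factors S. x < real p}"
  have h_nonneg: "0 \<le> ?h p" for p by (simp add: sum_nonneg)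
  have h_ge_1: "1 \<le> ?h p" for p
    using member_le_sum[of 0 "{..<t}" "\<lambda>j. (1 / real p) ^ j"] assms(2) by auto
  have cover: "prime_factors S \<subseteq> primes_upto x \<union> Q" and disjoint: "primes_upto x \<inter> Q = {}"
    by (auto simp: primes_upto_def Q_def)
  have "prod ?h (prime_factors S) \<le> prod ?h (primes_upto x \<union> Q)"
    using cover h_nonneg h_ge_1 by (intro prod_mono2) (simp_all add: Q_def)
  also have "\<dots> = prod ?h (primes_upto x) * prod ?h Q"
    using disjoint by (intro prod.union_disjoint) (simp_all add: Q_def)
  also have "\<dots> \<le> ((1 - (1 / 2) ^ t) * exp (log_euler_product x)) * exp (ln (real S) / ((x - 1) * ln x))"
  proof (intro mult_mono prod_sum_power_inverse_primes_upto_le prod_nonneg assms(3))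
    have "prod ?h Q \<le> (\<Prod>p\<in>Q. exp (log_euler_factor p))"
      using h_nonneg by (intro prod_mono) (auto simp: Q_def intro!: sum_power_inverse_prime_le)
    also have "\<dots> = exp (\<Sum>p\<in>Q. log_euler_factor p)"
      by (simp add: Q_def exp_sum)
    also have "\<dots> \<le> exp (ln (real S) / ((x - 1) * ln x))"
      using sum_log_euler_factor_prime_factors_greater_le[of S x] assms by (simp add: Q_def)
    finally show "prod ?h Q \<le> exp (ln (real S) / ((x - 1) * ln x))" .
  qed (use h_nonneg in \<open>auto simp: power_le_one\<close>)
  finally show ?thesis by (simp add: exp_add mult.assoc)
qed

theorem robin_inequality_t_free:
  assumes "t_free t S" "S > 0" "t > 0" "16 * 2 ^ t < ln (ln (real S))"
  shows "real (divisor_sigma S) < exp euler_mascheroni * real S * ln (ln (real S))"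
proof -
  define y where "y = ln (real S)"
  have "1 \<le> (2::real) ^ t" by simp
  then have ln_y: "16 < ln y" using assms(4) unfolding y_def by linarith
  have "y \<noteq> 0" using ln_y by auto
  then have "y > 0" using assms(2) by (auto simp: y_def)
  then have y: "y \<ge> 2" using ln_y ln_le_minus_one[of y] by linarith
  have "y / ((y - 1) * ln y) \<le> 2 / ln y"
    using y ln_y by (simp add: field_simps)
  then have exponent: "log_euler_product y + y / ((y - 1) * ln y) \<le> ln (ln y) + euler_mascheroni + 16 / ln y"
    using mertens_third_upper[OF y] by simp
  have saving: "16 / ln y < (1 / 2) ^ t"
    using assms(4) ln_y by (simp add: y_def field_simps power_divide)
  have "real (divisor_sigma S) / real S \<le> (\<Prod>p\<in>prime_factors S. \<Sum>j<t. (1 / real p) ^ j)"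
    using assms by (intro divisor_sigma_div_le_prod)
  also have "\<dots> \<le> (1 - (1 / 2) ^ t) * exp (log_euler_product y + y / ((y - 1) * ln y))"
    using prod_prime_factors_le[OF assms(2,3) y] by (simp add: y_def)
  also have "\<dots> \<le> exp (- ((1 / 2) ^ t)) * exp (ln (ln y) + euler_mascheroni + 16 / ln y)"
    using exponent exp_ge_add_one_self[of "- ((1 / 2) ^ t)"] by (intro mult_mono) auto
  also have "\<dots> < exp (ln (ln y) + euler_mascheroni)"
    using saving by (simp flip: exp_add)
  also have "\<dots> = exp euler_mascheroni * ln y"
    using ln_y by (simp add: exp_add)
  finally show ?thesis using assms(2) by (simp add: y_def field_simps)
qed

lemma two_power_le_primorial: "2 ^ n \<le> primorial n"
proof -
  have "2 \<le> nth_prime1 i" for i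
    using enumerate_in_set[OF primes_infinite, of "i - 1"] prime_ge_2_nat
    by (simp add: nth_prime1_def)
  then have "(\<Prod>i\<in>{1..n}. 2) \<le> primorial n" unfolding primorial_def by (intro prod_mono) auto
  then show ?thesis by simp
qed

lemma ln_ge_of_primorial_le:
  assumes "primorial n \<le> m"
  shows "real n * ln 2 \<le> ln (real m)"
proof -
  have "2 ^ n \<le> m"
    using two_power_le_primorial assms by (rule order_trans)
  then have "ln (2 ^ n) \<le> ln (real m)"
    by (intro ln_mono) (simp_all flip: of_nat_le_iff)
  then show ?thesis by (simp add: ln_realpow)
qed

lemma eventually_two_power_less_ln:
  fixes t :: "nat \<Rightarrow> nat" and c C :: real
  assumes "(\<lambda>n. real (t n)) \<in> o(\<lambda>n. ln (ln (real n)))" "c > 0" "C > 0"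
  shows "eventually (\<lambda>n. C * 2 ^ t n < ln (c * real n)) sequentially"
proof -
  have "eventually (\<lambda>n. real (t n) \<le> 1 / 2 * \<bar>ln (ln (real n))\<bar>) sequentially"
    using landau_o.smallD[OF assms(1), of "1 / 2"] by simp
  moreover have "eventually (\<lambda>n. ln (ln (real n)) > 0) sequentially"
    by real_asymp
  moreover have "eventually (\<lambda>n. C * exp (1 / 2 * ln (ln (real n))) < ln (c * real n)) sequentially"
    using assms(2,3) by real_asymp
  ultimately show ?thesis
  proof eventually_elim
    case (elim n)
    have "(2::real) ^ t n = exp (real (t n) * ln 2)"
      by (simp add: exp_of_nat_mult)
    also have "\<dots> \<le> exp (1 / 2 * ln (ln (real n)))"
      using elim mult_left_le[of "ln 2" "real (t n)"] ln_2_less_1 by simp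
    finally have "C * 2 ^ t n \<le> C * exp (1 / 2 * ln (ln (real n)))"
      using assms(3) by (intro mult_left_mono) auto
    then show ?case using elim by linarith
  qed
qed

theorem mainTheorem12:
  fixes t :: "nat \<Rightarrow> int" and S :: "nat \<Rightarrow> nat"
  assumes t_ge: "\<And>n. t n \<ge> 2"
    and t_small: "(\<lambda>n. real_of_int (t n)) \<in> o(\<lambda>n. ln (ln (real n)))"
    and S_pos: "\<And>n. S n > 0"
    and S_prop: "eventually (\<lambda>n. S n \<ge> primorial n \<and> t_free (nat (t n)) (S n)) sequentially"
  shows "eventually (\<lambda>n. real (divisor_sigma (S n))
           < exp euler_mascheroni * real (S n) * ln (ln (real (S n)))) sequentially"
proof -
  have "real (nat (t n)) = real_of_int (t n)" for n
    using t_ge[of n] by simp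
  then have "eventually (\<lambda>n. 16 * 2 ^ nat (t n) < ln (ln 2 * real n)) sequentially"
    using t_small by (intro eventually_two_power_less_ln) simp_all
  then show ?thesis
    using S_prop eventually_gt_at_top[of 0]
  proof eventually_elim
    case (elim n)
    have "ln (ln 2 * real n) \<le> ln (ln (real (S n)))"
      using elim ln_ge_of_primorial_le[of n "S n"] by (intro ln_mono) (auto simp: mult.commute)
    then show ?case
      using elim S_pos[of n] t_ge[of n] by (intro robin_inequality_t_free[of "nat (t n)"]) auto
  qed
qed

end
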